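(* For every integer $k\ge 1$, $sat_{\circlearrowright}(n,X_k)=O(1)$, where $X_k$ is the cyclically ordered matching on vertex set $[2k+4]$ (with the natural cyclic order $1,2,\dots,2k+4$) and edge set $\{\{1,2k+3\},\{2,2k+4\}\}\cup\{\{2i+1,2i+2\}: i=1,\dots,k\}$.
   Context: A cyclically ordered graph is a finite simple graph whose vertex set is cyclically ordered. $H$ contains $C$ if there is an injective cyclic-order-preserving map $\varphi:V(C)\to V(H)$ with $\varphi(u)\varphi(v)\in E(H)$ for all $uv\in E(C)$; otherwise $H$ avoids $C$. $H$ saturates $C$ if $H$ avoids $C$ but adding any non-edge to $H$ yields a graph containing $C$. $sat_{\circlearrowright}(n,C)$ is the minimum number of edges of a cyclically ordered graph on $n$ vertices saturating $C$. *)

theory Defs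
  imports Complex_Main "HOL-Library.Landau_Symbols"
begin

text \<open>A (total, strict) cyclic order on \<open>V\<close>, as a ternary relation: \<open>R a b c\<close> means that,
  starting from \<open>a\<close>, one meets \<open>b\<close> strictly before \<open>c\<close>. Cyclicity and asymmetry together force
  \<open>a\<close>, \<open>b\<close>, \<open>c\<close> to be distinct.\<close>

definition cyclic_order_on :: "'a set \<Rightarrow> ('a \<Rightarrow> 'a \<Rightarrow> 'a \<Rightarrow> bool) \<Rightarrow> bool" where
  "cyclic_order_on V R \<longleftrightarrow>
     (\<forall>a b c. R a b c \<longrightarrow> a \<in> V \<and> b \<in> V \<and> c \<in> V) \<and>
     (\<forall>a b c. R a b c \<longrightarrow> R b c a) \<and>
     (\<forall>a b c. R a b c \<longrightarrow> \<not> R c b a) \<and>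
     (\<forall>a b c d. R a b c \<longrightarrow> R a c d \<longrightarrow> R a b d) \<and>
     (\<forall>a\<in>V. \<forall>b\<in>V. \<forall>c\<in>V. a \<noteq> b \<longrightarrow> b \<noteq> c \<longrightarrow> a \<noteq> c \<longrightarrow> R a b c \<or> R c b a)"

definition natural_cyc :: "nat set \<Rightarrow> nat \<Rightarrow> nat \<Rightarrow> nat \<Rightarrow> bool" where
  "natural_cyc V a b c \<longleftrightarrow> a \<in> V \<and> b \<in> V \<and> c \<in> V \<and>
     (a < b \<and> b < c \<or> b < c \<and> c < a \<or> c < a \<and> a < b)"

lemma cyclic_order_natural_cyc: "cyclic_order_on V (natural_cyc V)"
  unfolding cyclic_order_on_def
proof (intro conjI)
  show "\<forall>a b c. natural_cyc V a b c \<longrightarrow> a \<in> V \<and> b \<in> V \<and> c \<in> V"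
    unfolding natural_cyc_def by blast
  show "\<forall>a b c. natural_cyc V a b c \<longrightarrow> natural_cyc V b c a"
    unfolding natural_cyc_def by blast
  show "\<forall>a b c. natural_cyc V a b c \<longrightarrow> \<not> natural_cyc V c b a"
    unfolding natural_cyc_def by (intro allI impI notI) linarith
  show "\<forall>a b c d. natural_cyc V a b c \<longrightarrow> natural_cyc V a c d \<longrightarrow> natural_cyc V a b d"
    unfolding natural_cyc_def by (intro allI impI, elim conjE, intro conjI, assumption+, elim disjE; linarith)
  show "\<forall>a\<in>V. \<forall>b\<in>V. \<forall>c\<in>V. a \<noteq> b \<longrightarrow> b \<noteq> c \<longrightarrow> a \<noteq> c \<longrightarrow>
      natural_cyc V a b c \<or> natural_cyc V c b a"
    unfolding natural_cyc_def by (intro ballI impI) (simp, linarith)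
qed

record 'a cograph =
  verts :: "'a set"
  edges :: "'a set set"
  cyc :: "'a \<Rightarrow> 'a \<Rightarrow> 'a \<Rightarrow> bool"

definition cyc_ordered_graph :: "'a cograph \<Rightarrow> bool" where
  "cyc_ordered_graph H \<longleftrightarrow>
     finite (verts H) \<and> edges H \<subseteq> {e. e \<subseteq> verts H \<and> card e = 2} \<and>
     cyclic_order_on (verts H) (cyc H)"

definition contains :: "'b cograph \<Rightarrow> 'a cograph \<Rightarrow> bool" where
  "contains H C \<longleftrightarrow> (\<exists>\<phi>. inj_on \<phi> (verts C) \<and> \<phi> ` verts C \<subseteq> verts H \<and>
     (\<forall>a\<in>verts C. \<forall>b\<in>verts C. \<forall>c\<in>verts C. cyc C a b c \<longrightarrow> cyc H (\<phi> a) (\<phi> b) (\<phi> c)) \<and>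
     (\<forall>u v. {u, v} \<in> edges C \<longrightarrow> {\<phi> u, \<phi> v} \<in> edges H))"

definition saturates :: "'b cograph \<Rightarrow> 'a cograph \<Rightarrow> bool" where
  "saturates H C \<longleftrightarrow> \<not> contains H C \<and>
     (\<forall>u\<in>verts H. \<forall>v\<in>verts H. u \<noteq> v \<longrightarrow> {u, v} \<notin> edges H \<longrightarrow>
        contains (H\<lparr>edges := insert {u, v} (edges H)\<rparr>) C)"

text \<open>Every finite cyclically ordered graph has an isomorphic copy on a set of natural numbers, so
  restricting the vertices of \<open>H\<close> to type \<^typ>\<open>nat\<close> loses nothing. The minimum is attained as soon
  as \<open>C\<close> has an edge; see \<open>sat_cyc_attained\<close> below.\<close>

definition sat_cyc :: "nat \<Rightarrow> 'a cograph \<Rightarrow> nat" where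
  "sat_cyc n C = (LEAST m. \<exists>H :: nat cograph. cyc_ordered_graph H \<and> card (verts H) = n \<and>
     saturates H C \<and> card (edges H) = m)"

lemma ex_saturates:
  fixes C :: "'a cograph"
  assumes "cyc_ordered_graph C" and "edges C \<noteq> {}"
  shows "\<exists>H :: nat cograph. cyc_ordered_graph H \<and> card (verts H) = n \<and> saturates H C"
proof -
  define G where "G E = \<lparr>verts = {..<n}, edges = E, cyc = natural_cyc {..<n}\<rparr>" for E
  let ?P = "{e. e \<subseteq> {..<n} \<and> card e = 2}"
  let ?S = "{E. E \<subseteq> ?P \<and> \<not> contains (G E) C}"
  obtain e where e: "e \<in> edges C" using assms by blast
  then have "card e = 2" using assms by (auto simp: cyc_ordered_graph_def)
  then obtain x y where "e = {x, y}" by (auto simp: card_2_iff)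
  then have "\<not> contains (G {}) C" using e unfolding contains_def G_def by fastforce
  then have ne: "?S \<noteq> {}" by blast
  have fin: "finite ?S"
    by (rule finite_subset[of _ "Pow (Pow {..<n})"]) auto
  from finite_has_maximal[OF fin ne] obtain E
    where E: "E \<in> ?S" and mx': "\<forall>E'\<in>?S. E \<subseteq> E' \<longrightarrow> E = E'" ..
  have mx: "E = E'" if "E' \<in> ?S" "E \<subseteq> E'" for E'
    using mx'[rule_format, OF that] .
  have "saturates (G E) C"
    unfolding saturates_def
  proof (intro conjI ballI impI)
    show "\<not> contains (G E) C" using E by blast
    fix u v assume uv: "u \<in> verts (G E)" "v \<in> verts (G E)" "u \<noteq> v" "{u, v} \<notin> edges (G E)"
    have "insert {u, v} E \<subseteq> ?P" using uv E by (auto simp: G_def)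
    moreover have "insert {u, v} E \<noteq> E" using uv by (auto simp: G_def)
    ultimately have "contains (G (insert {u, v} E)) C"
      using mx[of "insert {u, v} E"] by blast
    then show "contains (G E\<lparr>edges := insert {u, v} (edges (G E))\<rparr>) C"
      by (simp add: G_def)
  qed
  moreover have "cyc_ordered_graph (G E)"
    using E by (auto simp: cyc_ordered_graph_def G_def cyclic_order_natural_cyc)
  moreover have "card (verts (G E)) = n" by (simp add: G_def)
  ultimately show ?thesis by blast
qed

lemma sat_cyc_attained:
  fixes C :: "'a cograph"
  assumes "cyc_ordered_graph C" and "edges C \<noteq> {}"
  shows "\<exists>H :: nat cograph. cyc_ordered_graph H \<and> card (verts H) = n \<and>
     saturates H C \<and> card (edges H) = sat_cyc n C"
  unfolding sat_cyc_def using ex_saturates[OF assms, of n] by (rule_tac LeastI_ex) blast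

definition X :: "nat \<Rightarrow> nat cograph" where
  "X k = \<lparr>verts = {1..2*k+4},
          edges = {{1, 2*k+3}, {2, 2*k+4}} \<union> {{2*i+1, 2*i+2} |i. i \<in> {1..k}},
          cyc = natural_cyc {1..2*k+4}\<rparr>"

lemma cyc_ordered_graph_X: "cyc_ordered_graph (X k)"
proof -
  have "edges (X k) \<subseteq> {e. e \<subseteq> verts (X k) \<and> card e = 2}"
    unfolding X_def by auto
  then show ?thesis
    by (simp add: cyc_ordered_graph_def X_def cyclic_order_natural_cyc)
qed

end

theory Submission
  imports Defs
begin

text \<open>Put \<open>M = 2k + 1\<close> and take a core \<open>{1..2M}\<close> followed by a single interval of isolated vertices.
  The core carries the pairwise crossing edges \<open>{i, i + M}\<close>, and \<open>k\<close> short edges on each side: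
  \<open>{1,2}, \<dots>, {2k-1,2k}\<close> and \<open>{M+2,M+3}, \<dots>, {2M-1,2M}\<close>. Only the long edges cross others, and
  if \<open>{a, c}\<close> is long, every arc cut off from one of its sides by a further vertex has fewer than
  \<open>2k\<close> core vertices, so it has no room for \<open>k\<close> disjoint edges. On the other hand, every new edge with
  an isolated end completes a copy of \<open>X k\<close>. Hence each maximal \<open>X k\<close>-avoiding extension adds
  edges inside the core only, whose size does not depend on \<open>n\<close>.\<close>

section \<open>Bounding saturation numbers and exhibiting copies of \<open>X k\<close>\<close>

lemma contains_mono:
  assumes "contains H C" "verts H \<subseteq> verts H'" "cyc H = cyc H'" "edges H \<subseteq> edges H'"
  shows "contains H' C"
proof -
  from assms(1) obtain \<phi> where "inj_on \<phi> (verts C)" "\<phi> ` verts C \<subseteq> verts H"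
    "\<forall>a\<in>verts C. \<forall>b\<in>verts C. \<forall>c\<in>verts C. cyc C a b c \<longrightarrow> cyc H (\<phi> a) (\<phi> b) (\<phi> c)"
    "\<forall>u v. {u, v} \<in> edges C \<longrightarrow> {\<phi> u, \<phi> v} \<in> edges H"
    unfolding contains_def by blast
  then show ?thesis
    using assms(2-4) unfolding contains_def by (intro exI[of _ \<phi>]) auto
qed

text \<open>A maximal \<open>C\<close>-avoiding extension of \<open>H\<close> on the same vertices
  is saturated. It has no edge outside \<open>B\<close>: such an edge together with \<open>H\<close>
  already contains \<open>C\<close>, and containment survives adding edges.\<close>

lemma sat_cyc_le:
  fixes H :: "nat cograph"
  assumes H: "cyc_ordered_graph H" and av: "\<not> contains H C" and fin: "finite B"
    and new: "\<And>u v. \<lbrakk>u \<in> verts H; v \<in> verts H; u \<noteq> v; {u, v} \<notin> B\<rbrakk> \<Longrightarrow>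
      contains (H\<lparr>edges := insert {u, v} (edges H)\<rparr>) C"
  shows "sat_cyc (card (verts H)) C \<le> card B"
proof -
  let ?P = "{e. e \<subseteq> verts H \<and> card e = 2}"
  let ?S = "{E. edges H \<subseteq> E \<and> E \<subseteq> ?P \<and> \<not> contains (H\<lparr>edges := E\<rparr>) C}"
  have finV: "finite (verts H)" and HP: "edges H \<subseteq> ?P"
    and cyc: "cyclic_order_on (verts H) (cyc H)"
    using H by (auto simp: cyc_ordered_graph_def)
  have "finite ?S"
    by (rule finite_subset[of _ "Pow (Pow (verts H))"]) (use finV in auto)
  moreover have "edges H \<in> ?S" using HP av by simp
  ultimately obtain E where E: "E \<in> ?S" and mx: "\<And>F. F \<in> ?S \<Longrightarrow> E \<subseteq> F \<Longrightarrow> E = F"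
    using finite_has_maximal[of ?S] by (metis (no_types, lifting) empty_iff)
  let ?G = "H\<lparr>edges := E\<rparr>"
  have "cyc_ordered_graph ?G"
    using E finV cyc by (auto simp: cyc_ordered_graph_def)
  moreover have "saturates ?G C"
    unfolding saturates_def
  proof (intro conjI ballI impI)
    show "\<not> contains ?G C" using E by blast
    fix u v assume uv: "u \<in> verts ?G" "v \<in> verts ?G" "u \<noteq> v" "{u, v} \<notin> edges ?G"
    then have "edges H \<subseteq> insert {u, v} E" "insert {u, v} E \<subseteq> ?P" "insert {u, v} E \<noteq> E"
      using E by auto
    then have "contains (H\<lparr>edges := insert {u, v} E\<rparr>) C"
      using mx[of "insert {u, v} E"] by blast
    then show "contains (?G\<lparr>edges := insert {u, v} (edges ?G)\<rparr>) C" by simp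
  qed
  ultimately have "sat_cyc (card (verts H)) C \<le> card E"
    unfolding sat_cyc_def by (intro Least_le exI[of _ ?G]) auto
  also have "E \<subseteq> B"
  proof
    fix e assume e: "e \<in> E"
    then obtain u v where uv: "e = {u, v}" "u \<noteq> v" "u \<in> verts H" "v \<in> verts H"
      using E by (auto simp: card_2_iff)
    show "e \<in> B"
    proof (rule ccontr)
      assume "e \<notin> B"
      then have "contains (H\<lparr>edges := insert e (edges H)\<rparr>) C" using new uv by simp
      then have "contains ?G C" by (rule contains_mono) (use E e in auto)
      then show False using E by simp
    qed
  qed
  then have "card E \<le> card B" by (rule card_mono[OF fin])
  finally show ?thesis .
qed

text \<open>The vertex map may wrap around once: it increases up to position \<open>r\<close>, drops below all
  earlier values and increases again.\<close>

lemma contains_XI: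
  assumes ran: "\<And>x. 1 \<le> x \<Longrightarrow> x \<le> 2*k+4 \<Longrightarrow> f x \<in> {1..n}"
    and ord: "\<And>x y. \<lbrakk>1 \<le> x; x < y; y \<le> 2*k+4\<rbrakk> \<Longrightarrow>
      if x \<le> r \<and> r < y then f y < f x else f x < f y"
    and cross: "{f 1, f (2*k+3)} \<in> E" "{f 2, f (2*k+4)} \<in> E"
    and short: "\<And>i. 1 \<le> i \<Longrightarrow> i \<le> k \<Longrightarrow> {f (2*i+1), f (2*i+2)} \<in> E"
  shows "contains \<lparr>verts = {1..n}, edges = E, cyc = natural_cyc {1..n}\<rparr> (X k)"
  unfolding contains_def
proof (intro exI[of _ f] conjI)
  have neq: "f x \<noteq> f y" if "1 \<le> x" "x < y" "y \<le> 2*k+4" for x y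
    using ord[OF that] by (auto split: if_splits)
  show "inj_on f (verts (X k))"
    by (rule linorder_inj_onI) (use neq in \<open>auto simp: X_def\<close>)
  show "f ` verts (X k) \<subseteq> verts \<lparr>verts = {1..n}, edges = E, cyc = natural_cyc {1..n}\<rparr>"
    using ran by (auto simp: X_def)
  have inc: "natural_cyc {1..n} (f a) (f b) (f c)"
    if "1 \<le> a" "a < b" "b < c" "c \<le> 2*k+4" for a b c
    using ord[of a b] ord[of b c] ord[of a c] that ran[of a] ran[of b] ran[of c]
    by (auto simp: natural_cyc_def split: if_splits)
  have rot: "natural_cyc {1..n} x y z \<Longrightarrow> natural_cyc {1..n} y z x" for x y z
    by (auto simp: natural_cyc_def)
  show "\<forall>a\<in>verts (X k). \<forall>b\<in>verts (X k). \<forall>c\<in>verts (X k). cyc (X k) a b c \<longrightarrow>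
      cyc \<lparr>verts = {1..n}, edges = E, cyc = natural_cyc {1..n}\<rparr> (f a) (f b) (f c)"
  proof (intro ballI impI)
    fix a b c assume v: "a \<in> verts (X k)" "b \<in> verts (X k)" "c \<in> verts (X k)"
      and "cyc (X k) a b c"
    then consider "a < b" "b < c" | "b < c" "c < a" | "c < a" "a < b"
      by (auto simp: X_def natural_cyc_def)
    then have "natural_cyc {1..n} (f a) (f b) (f c)"
      by cases (use v inc[of a b c] rot[OF rot, OF inc[of b c a]] rot[OF inc[of c a b]]
        in \<open>simp_all add: X_def\<close>)
    then show "cyc \<lparr>verts = {1..n}, edges = E, cyc = natural_cyc {1..n}\<rparr> (f a) (f b) (f c)"
      by simp
  qed
  \<comment> \<open>Images of edges as sets avoid a split over the two orders of the
    endpoints.\<close>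
  have "f ` e \<in> E" if "e \<in> edges (X k)" for e
    using that cross short by (auto simp: X_def)
  from this[of "{_, _}"]
  show "\<forall>u v. {u, v} \<in> edges (X k) \<longrightarrow>
      {f u, f v} \<in> edges \<lparr>verts = {1..n}, edges = E, cyc = natural_cyc {1..n}\<rparr>"
    by simp
qed

section \<open>The core graph and its avoidance of \<open>X k\<close>\<close>

text \<open>With \<open>M = 2k+1\<close>, the short edges miss exactly \<open>M\<close> and
  \<open>M+1\<close>. Hence \<open>{1, M+1}\<close> can be used with all right short edges, and
  \<open>{M, 2M}\<close> with all left ones.\<close>

definition core_edges :: "nat \<Rightarrow> nat set set" where
  "core_edges k = {{i, i + (2*k+1)} |i. i \<in> {1..2*k+1}} \<union> {{2*l-1, 2*l} |l. l \<in> {1..k}}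
     \<union> {{2*k+1+2*l, 2*k+2+2*l} |l. l \<in> {1..k}}"

definition core_graph :: "nat \<Rightarrow> nat \<Rightarrow> nat cograph" where
  "core_graph k n = \<lparr>verts = {1..n}, edges = core_edges k, cyc = natural_cyc {1..n}\<rparr>"

lemma core_edges_subset: "e \<in> core_edges k \<Longrightarrow> e \<subseteq> {1..4*k+2} \<and> card e = 2"
  by (auto simp: core_edges_def card_insert_if)

lemma core_edges_cases:
  assumes "{x, y} \<in> core_edges k"
  obtains "y = x + (2*k+1)" | "x = y + (2*k+1)" | "y = x + 1" | "x = y + 1"
  using assms by (auto simp: core_edges_def doubleton_eq_iff)

lemma long_edgeI: "1 \<le> i \<Longrightarrow> i \<le> 2*k+1 \<Longrightarrow> j = i + (2*k+1) \<Longrightarrow> {i, j} \<in> core_edges k"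
  unfolding core_edges_def by auto

lemma left_edgeI: "1 \<le> l \<Longrightarrow> l \<le> k \<Longrightarrow> i = 2*l-1 \<Longrightarrow> j = 2*l \<Longrightarrow> {i, j} \<in> core_edges k"
  unfolding core_edges_def by auto

lemma right_edgeI:
  "1 \<le> l \<Longrightarrow> l \<le> k \<Longrightarrow> i = 2*k+1+2*l \<Longrightarrow> j = 2*k+2+2*l \<Longrightarrow> {i, j} \<in> core_edges k"
  unfolding core_edges_def by auto

lemma cyc_ordered_core_graph:
  assumes "4*k+2 \<le> n"
  shows "cyc_ordered_graph (core_graph k n)"
  using core_edges_subset assms
  by (fastforce simp: cyc_ordered_graph_def core_graph_def cyclic_order_natural_cyc)

lemma core_graph_avoids:
  assumes "k \<ge> 1"
  shows "\<not> contains (core_graph k n) (X k)"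
proof
  assume "contains (core_graph k n) (X k)"
  then obtain f where inj: "inj_on f (verts (X k))"
    and cyc: "\<forall>a\<in>verts (X k). \<forall>b\<in>verts (X k). \<forall>c\<in>verts (X k). cyc (X k) a b c \<longrightarrow>
      cyc (core_graph k n) (f a) (f b) (f c)"
    and ed': "\<forall>u v. {u, v} \<in> edges (X k) \<longrightarrow> {f u, f v} \<in> edges (core_graph k n)"
    unfolding contains_def by blast
  have ed: "{f u, f v} \<in> core_edges k" if "{u, v} \<in> edges (X k)" for u v
    using ed' that by (simp add: core_graph_def)
  have inc: "natural_cyc {1..n} (f a) (f b) (f c)"
    if "1 \<le> a" "a < b" "b < c" "c \<le> 2*k+4" for a b c
    using cyc[rule_format, of a b c] that by (simp add: X_def core_graph_def natural_cyc_def)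
  define a b c d where "a = f 1" and "b = f 2" and "c = f (2*k+3)" and "d = f (2*k+4)"
  have ac: "{a, c} \<in> core_edges k" unfolding a_def c_def by (rule ed) (simp add: X_def)
  have bd: "{b, d} \<in> core_edges k" unfolding b_def d_def by (rule ed) (simp add: X_def)
  have abc: "natural_cyc {1..n} a b c" and acd: "natural_cyc {1..n} a c d"
    unfolding a_def b_def c_def d_def by (rule inc; simp)+
  have core: "a \<in> {1..4*k+2}" "b \<in> {1..4*k+2}" "c \<in> {1..4*k+2}"
    using core_edges_subset[OF ac] core_edges_subset[OF bd] by auto
  \<comment> \<open>A short edge joins consecutive labels, so one of its two arcs is empty, whereas
    \<open>b\<close> and \<open>d\<close> lie on opposite sides of \<open>{a, c}\<close>.\<close>
  have long: "c = a + (2*k+1) \<or> a = c + (2*k+1)"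
    using ac by (rule core_edges_cases) (use abc acd in \<open>auto simp: natural_cyc_def\<close>)
  let ?S = "f ` {3..2*k+2}"
  \<comment> \<open>Only core vertices count: the \<open>2*k\<close> ends of the short edges of the
    copy are non-isolated and lie strictly between \<open>b\<close> and \<open>c\<close>.\<close>
  let ?A = "{x \<in> {1..4*k+2}. natural_cyc {1..n} b x c}"
  have "?S \<subseteq> ?A"
  proof (rule image_subsetI)
    fix x assume x: "x \<in> {3..2*k+2}"
    \<comment> \<open>The index of the short edge of \<open>X k\<close> with end
      \<open>x\<close>.\<close>
    define i where "i = (x - 1) div 2"
    have i: "i \<in> {1..k}" "x = 2*i+1 \<or> x = 2*i+2" using x unfolding i_def by auto
    then have "{f (2*i+1), f (2*i+2)} \<in> core_edges k" by (intro ed) (auto simp: X_def)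
    then have "f x \<in> {1..4*k+2}" using core_edges_subset i(2) by blast
    moreover have "natural_cyc {1..n} b (f x) c"
      unfolding b_def c_def by (rule inc) (use x in auto)
    ultimately show "f x \<in> ?A" by blast
  qed
  then have "card ?S \<le> card ?A" by (intro card_mono) auto
  also have "card ?S = 2*k"
    by (subst card_image) (auto simp: X_def intro: inj_on_subset[OF inj])
  also have "card ?A < 2*k"
  proof (cases "b < c")
    case True
    then have "?A \<subseteq> {b<..<c}" by (auto simp: natural_cyc_def)
    then have "card ?A \<le> card {b<..<c}" by (intro card_mono) auto
    \<comment> \<open>Either \<open>a < b < c = a + M\<close>, or \<open>c = a - M \<le> M\<close>
      and \<open>b \<ge> 1\<close>; both leave at most \<open>M - 2 = 2k - 1\<close>
      vertices.\<close>
    also have "\<dots> < 2*k" using True long abc core assms by (auto simp: natural_cyc_def)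
    finally show ?thesis .
  next
    case False
    \<comment> \<open>The arc now wraps through the isolated interval. Here \<open>c < a < b\<close>
      and \<open>a = c + M\<close>, so \<open>b > c + M\<close> and again at most
      \<open>M - 2\<close> core vertices remain.\<close>
    then have "?A \<subseteq> {1..<c} \<union> {b<..4*k+2}" by (auto simp: natural_cyc_def)
    then have "card ?A \<le> card ({1..<c} \<union> {b<..4*k+2})" by (intro card_mono) auto
    also have "\<dots> \<le> (c - 1) + (4*k+2 - b)" by (rule order_trans[OF card_Un_le]) simp
    also have "\<dots> < 2*k" using False long abc core by (auto simp: natural_cyc_def)
    finally show ?thesis .
  qed
  finally show False by simp
qed

section \<open>New edges with an isolated end, and the resulting bound\<close>

text \<open>If \<open>w\<close> is a core vertex other than \<open>1\<close> and
  \<open>4*k+2\<close>, then \<open>{v, w}\<close> crosses a long edge and serves in the crossing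
  pair. Otherwise it crosses no core edge and must be a short edge of the copy, which spares one
  short edge of the core.\<close>

lemma core_graph_new_edge:
  assumes "k \<ge> 1" "4*k+2 < v" "v \<le> n" "1 \<le> w" "w \<le> 4*k+2 \<or> v < w" "w \<le> n"
  shows "contains (core_graph k n\<lparr>edges := insert {v, w} (core_edges k)\<rparr>) (X k)"
proof -
  consider (left) "2 \<le> w" "w \<le> 2*k+1" | (right) "2*k+2 \<le> w" "w \<le> 4*k+1"
    | (first) "w = 1 \<or> v < w" | (last) "w = 4*k+2"
    using assms by linarith
  then have "contains \<lparr>verts = {1..n}, edges = insert {v, w} (core_edges k),
      cyc = natural_cyc {1..n}\<rparr> (X k)"
  proof cases
    case left
    \<comment> \<open>\<open>{v, w}\<close> crosses the long edge \<open>{1, M+1}\<close>, followed by the right short edges.\<close>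
    define f where "f x = (if x = 1 then w else if x = 2*k+4 then 1 else
      if x = 2*k+3 then v else 2*k+x)" for x
    show ?thesis
    proof (rule contains_XI[where f = f and r = "2*k+3"])
      show "{f 1, f (2*k+3)} \<in> insert {v, w} (core_edges k)"
        using assms(1) by (auto simp: f_def)
      show "{f 2, f (2*k+4)} \<in> insert {v, w} (core_edges k)"
        by (subst insert_commute) (auto simp: f_def intro!: long_edgeI)
      show "{f (2*i+1), f (2*i+2)} \<in> insert {v, w} (core_edges k)" if "1 \<le> i" "i \<le> k" for i
        using that by (auto simp: f_def intro!: right_edgeI[of i])
    qed (use left assms in \<open>auto simp: f_def\<close>)
  next
    case right
    \<comment> \<open>\<open>{v, w}\<close> crosses the long edge \<open>{M, 2M}\<close>, preceded by the left short edges.\<close>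
    define f where "f x = (if x = 1 then 4*k+2 else if x = 2 then v else
      if x = 2*k+4 then w else x - 2)" for x
    show ?thesis
    proof (rule contains_XI[where f = f and r = 2])
      show "{f 1, f (2*k+3)} \<in> insert {v, w} (core_edges k)"
        by (subst insert_commute) (auto simp: f_def intro!: long_edgeI)
      show "{f 2, f (2*k+4)} \<in> insert {v, w} (core_edges k)"
        by (auto simp: f_def)
      show "{f (2*i+1), f (2*i+2)} \<in> insert {v, w} (core_edges k)" if "1 \<le> i" "i \<le> k" for i
        using that by (auto simp: f_def intro!: left_edgeI[of i])
    qed (use right assms in \<open>auto simp: f_def\<close>)
  next
    case first
    \<comment> \<open>\<open>{v, w}\<close> is the last short edge; the crossing pair is \<open>{2, M+2}\<close>, \<open>{3, M+3}\<close>.\<close>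
    define f where "f x = (if x \<le> 2*k then 2*k+2+x else if x = 2*k+1 then v else
      if x = 2*k+2 then w else if x = 2*k+3 then 2 else 3)" for x
    show ?thesis
    \<comment> \<open>If \<open>w = 1\<close>, the wrap occurs between \<open>v\<close> and
      \<open>w\<close>; if \<open>w\<close> is isolated, it occurs after \<open>w\<close>.\<close>
    proof (rule contains_XI[where f = f and r = "if w = 1 then 2*k+1 else 2*k+2"])
      show "{f 1, f (2*k+3)} \<in> insert {v, w} (core_edges k)"
        using assms(1) by (subst insert_commute) (auto simp: f_def intro!: long_edgeI)
      show "{f 2, f (2*k+4)} \<in> insert {v, w} (core_edges k)"
        using assms(1) by (subst insert_commute) (auto simp: f_def intro!: long_edgeI)
      show "{f (2*i+1), f (2*i+2)} \<in> insert {v, w} (core_edges k)" if "1 \<le> i" "i \<le> k" for i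
        using that by (cases "i = k") (auto simp: f_def intro!: right_edgeI[of "Suc i"])
    qed (use first assms in \<open>auto simp: f_def\<close>)
  next
    case last
    \<comment> \<open>\<open>{w, v}\<close> is the first short edge; the crossing pair is \<open>{M-2, 2M-2}\<close>, \<open>{M-1, 2M-1}\<close>.\<close>
    define f where "f x = (if x \<le> 3 then 4*k-1+x else if x = 4 then v else x - 4)" for x
    show ?thesis
    proof (rule contains_XI[where f = f and r = 4])
      show "{f 1, f (2*k+3)} \<in> insert {v, w} (core_edges k)"
        using assms(1) by (subst insert_commute) (auto simp: f_def intro!: long_edgeI)
      show "{f 2, f (2*k+4)} \<in> insert {v, w} (core_edges k)"
        using assms(1) by (subst insert_commute) (auto simp: f_def intro!: long_edgeI)
      show "{f (2*i+1), f (2*i+2)} \<in> insert {v, w} (core_edges k)" if "1 \<le> i" "i \<le> k" for i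
        using that last by (cases "i = 1") (auto simp: f_def intro!: left_edgeI[of "i - 1"])
    qed (use last assms in \<open>auto simp: f_def\<close>)
  qed
  then show ?thesis by (simp add: core_graph_def)
qed

lemma sat_cyc_X_le:
  assumes "k \<ge> 1" "4*k+2 \<le> n"
  shows "sat_cyc n (X k) \<le> 2 ^ (4*k+2)"
proof -
  \<comment> \<open>All subsets of the core form a crude but finite superset of the pairs inside it,
    of size independent of \<open>n\<close>.\<close>
  have "sat_cyc (card (verts (core_graph k n))) (X k) \<le> card (Pow {1..4*k+2})"
  proof (rule sat_cyc_le)
    fix u v assume uv: "u \<in> verts (core_graph k n)" "v \<in> verts (core_graph k n)" "u \<noteq> v"
      "{u, v} \<notin> Pow {1..4*k+2}"
    then have range: "u \<in> {1..n}" "v \<in> {1..n}" by (auto simp: core_graph_def)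
    \<comment> \<open>Orients the pair: its smaller isolated end takes the role of \<open>v\<close>
      in \<open>core_graph_new_edge\<close>.\<close>
    have "4*k+2 < u \<and> (v \<le> 4*k+2 \<or> u < v) \<or> 4*k+2 < v \<and> (u \<le> 4*k+2 \<or> v < u)"
      using uv range by auto
    then show "contains (core_graph k n\<lparr>edges := insert {u, v} (edges (core_graph k n))\<rparr>) (X k)"
      using core_graph_new_edge[of k u n v] core_graph_new_edge[of k v n u] assms range
      by (auto simp: core_graph_def insert_commute)
  qed (use assms cyc_ordered_core_graph core_graph_avoids in auto)
  then show ?thesis by (simp add: core_graph_def card_Pow)
qed

theorem theorem8:
  fixes k :: nat
  assumes "k \<ge> 1"
  shows "(\<lambda>n. real (sat_cyc n (X k))) \<in> O(\<lambda>_. 1)"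
proof (rule bigoI)
  show "\<forall>\<^sub>F n in sequentially. norm (real (sat_cyc n (X k))) \<le> 2 ^ (4*k+2) * norm (1 :: real)"
    using eventually_ge_at_top[of "4*k+2"]
  proof eventually_elim
    case (elim n)
    have "real (sat_cyc n (X k)) \<le> real (2 ^ (4*k+2))"
      using sat_cyc_X_le[OF assms elim] by (simp only: of_nat_le_iff)
    then show ?case by simp
  qed
qed

end
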